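(* Let $T\subseteq\mathbb{F}_2^n$ and define $T+\star\subseteq\mathbb{F}_2^{n+1}$ by \[T+\star:=\{\mathbf{v}0\mid \mathbf{v}\in T\}\cup\{\mathbf{v}1\mid \mathbf{v}\in\mathbb{F}_2^n\setminus T\},\] where $\mathbf{v}a$ denotes $\mathbf{v}$ with the bit $a$ appended. Then $T$ is a powerful set if and only if $T+\star$ is a powerful set.
   Context: A set $S\subseteq\mathbb{F}_2^n$ (positions indexed by $[n]=\{1,\dots,n\}$) is called a powerful set if for every $X\subseteq[n]$ the number of vectors in $S$ whose coordinates in all positions of $X$ are zero is a power of $2$. *)

theory Defs
  imports "HOL-Library.Z2" "Jordan_Normal_Form.Matrix"
begin

(* F_2^n is "carrier_vec n :: bit vec set"; the positions 1, ..., n are indexed by 0, ..., n - 1. *)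

definition powerful_set :: "nat \<Rightarrow> bit vec set \<Rightarrow> bool" where
  "powerful_set n S \<longleftrightarrow> S \<subseteq> carrier_vec n \<and>
     (\<forall>X \<subseteq> {0..<n}. \<exists>k::nat. card {v \<in> S. \<forall>i\<in>X. v $ i = 0} = 2 ^ k)"

definition append_bit :: "bit vec \<Rightarrow> bit \<Rightarrow> bit vec" where
  "append_bit v a = v @\<^sub>v vec_of_list [a]"

(* T + \<star>. The dimension n is an explicit argument because the complement of T is taken in F_2^n
   and n is not determined by T when T is empty. *)
definition plus_star :: "nat \<Rightarrow> bit vec set \<Rightarrow> bit vec set" where
  "plus_star n T = {append_bit v 0 | v. v \<in> T} \<union> {append_bit v 1 | v. v \<in> carrier_vec n - T}"

end

theory Submission
  imports Defs
begin

text \<open>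
  For a set \<open>X\<close> of old positions, dropping the appended bit identifies the vectors of \<open>T + \<star>\<close>
  vanishing on \<open>X\<close> with all vectors of \<open>F\<^sub>2\<^sup>n\<close> vanishing on \<open>X\<close>, a subspace of size
  \<open>2\<close> to the \<open>n - |X|\<close>. If the new position is required to vanish as well, exactly the vectors of \<open>T\<close>
  vanishing on \<open>X\<close> remain. So the conditions for \<open>T + \<star>\<close> are those for \<open>T\<close> and some that always hold.
\<close>

text \<open>A vector over \<open>bit\<close> is determined by its support, since an entry other than
  1 is 0. Vanishing on \<open>X\<close> means that the support avoids \<open>X\<close>, so the count
  is that of the subsets of \<open>{0..<n} - X\<close>; the inverse map sends a subset to its
  indicator vector.\<close>

lemma card_carrier_vec_zero_on:
  assumes "X \<subseteq> {0..<n}"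
  shows "card {v \<in> carrier_vec n :: bit vec set. \<forall>i\<in>X. v $ i = 0} = 2 ^ (n - card X)"
proof -
  have "bij_betw (\<lambda>v :: bit vec. {i. i < n \<and> v $ i = 1})
      {v \<in> carrier_vec n. \<forall>i\<in>X. v $ i = 0} (Pow ({0..<n} - X))"
  proof (rule bij_betw_byWitness[where f' = "\<lambda>A. vec n (\<lambda>i. if i \<in> A then 1 else 0)"])
    show "\<forall>v \<in> {v \<in> carrier_vec n :: bit vec set. \<forall>i\<in>X. v $ i = 0}.
        vec n (\<lambda>i. if i \<in> {i. i < n \<and> v $ i = 1} then 1 else 0) = v"
      by (auto intro!: eq_vecI)
    have "vec n (\<lambda>i. if i \<in> A then 1 else 0) $ i = (0 :: bit)"
      if "A \<subseteq> {0..<n} - X" "i \<in> X" for A i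
    proof -
      have "i < n" "i \<notin> A"
        using that assms by auto
      then show ?thesis by simp
    qed
    then show "(\<lambda>A. vec n (\<lambda>i. if i \<in> A then 1 else 0)) ` Pow ({0..<n} - X)
        \<subseteq> {v \<in> carrier_vec n :: bit vec set. \<forall>i\<in>X. v $ i = 0}"
      by auto
  qed (auto split: if_splits)
  then have "card {v \<in> carrier_vec n :: bit vec set. \<forall>i\<in>X. v $ i = 0} = card (Pow ({0..<n} - X))"
    by (rule bij_betw_same_card)
  also have "\<dots> = 2 ^ (n - card X)"
    using assms by (simp add: card_Pow card_Diff_subset finite_subset)
  finally show ?thesis .
qed

lemma append_bit_carrier_vec:
  "v \<in> carrier_vec n \<Longrightarrow> append_bit v a \<in> carrier_vec (n + 1)"
  by (rule carrier_vecI) (simp add: append_bit_def)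

lemma index_append_bit:
  assumes "v \<in> carrier_vec n"
  shows "i < n \<Longrightarrow> append_bit v a $ i = v $ i" and "append_bit v a $ n = a"
  using assms by (auto simp: append_bit_def)

lemma append_bit_zero_on:
  assumes "v \<in> carrier_vec n" "X \<subseteq> {0..<n}"
  shows "(\<forall>i\<in>X. append_bit v a $ i = 0) \<longleftrightarrow> (\<forall>i\<in>X. v $ i = 0)"
  using assms by (intro ball_cong refl) (auto simp: index_append_bit(1) subset_iff)

text \<open>Only the first \<open>n\<close> entries are compared, so \<open>a\<close> and
  \<open>b\<close> may be different terms. This gives injectivity even for a map whose appended bit
  depends on the vector.\<close>

lemma append_bit_eq_imp_eq:
  assumes "v \<in> carrier_vec n" "w \<in> carrier_vec n" "append_bit v a = append_bit w b"
  shows "v = w"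
proof (rule eq_vecI)
  fix i assume "i < dim_vec w"
  then show "v $ i = w $ i"
    using assms index_append_bit(1) by (metis carrier_vecD)
qed (use assms in auto)

lemma card_plus_star_zero_on_old:
  assumes "T \<subseteq> carrier_vec n" "X \<subseteq> {0..<n}"
  shows "card {w \<in> plus_star n T. \<forall>i\<in>X. w $ i = 0} = 2 ^ (n - card X)"
proof -
  \<comment> \<open>\<open>?f\<close> is the inverse of dropping the last bit: each vector of length
    \<open>n\<close> has exactly one extension in \<open>plus_star n T\<close>, and membership in
    \<open>T\<close> decides its last bit.\<close>
  let ?f = "\<lambda>v. append_bit v (if v \<in> T then 0 else 1)"
  have "plus_star n T = ?f ` carrier_vec n"
  proof
    show "plus_star n T \<subseteq> ?f ` carrier_vec n"
    proof
      fix w assume "w \<in> plus_star n T"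
      then consider v where "v \<in> T" "w = append_bit v 0"
        | v where "v \<in> carrier_vec n - T" "w = append_bit v 1"
        unfolding plus_star_def by blast
      then obtain v where "v \<in> carrier_vec n" "w = ?f v"
        by cases (use assms(1) in auto)
      then show "w \<in> ?f ` carrier_vec n"
        by blast
    qed
    show "?f ` carrier_vec n \<subseteq> plus_star n T"
    proof (rule image_subsetI)
      fix v :: "bit vec" assume "v \<in> carrier_vec n"
      then show "?f v \<in> plus_star n T"
        unfolding plus_star_def by (cases "v \<in> T") auto
    qed
  qed
  then have "{w \<in> plus_star n T. \<forall>i\<in>X. w $ i = 0}
      = ?f ` {v \<in> carrier_vec n. \<forall>i\<in>X. ?f v $ i = 0}"
    by (simp only: Compr_image_eq)
  also have "{v \<in> carrier_vec n. \<forall>i\<in>X. ?f v $ i = 0} = {v \<in> carrier_vec n. \<forall>i\<in>X. v $ i = 0}"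
    using append_bit_zero_on[OF _ assms(2)] by (intro Collect_cong conj_cong refl)
  finally have "{w \<in> plus_star n T. \<forall>i\<in>X. w $ i = 0}
      = ?f ` {v \<in> carrier_vec n. \<forall>i\<in>X. v $ i = 0}" .
  moreover have "inj_on ?f {v \<in> carrier_vec n. \<forall>i\<in>X. v $ i = 0}"
    by (rule inj_onI, rule append_bit_eq_imp_eq[where n = n]) simp_all
  ultimately show ?thesis
    using card_carrier_vec_zero_on[OF assms(2)] by (simp add: card_image)
qed

lemma card_plus_star_zero_on_new:
  assumes "T \<subseteq> carrier_vec n" "X \<subseteq> {0..<n}"
  shows "card {w \<in> plus_star n T. \<forall>i\<in>insert n X. w $ i = 0} = card {v \<in> T. \<forall>i\<in>X. v $ i = 0}"
proof -
  note old = append_bit_zero_on[OF _ assms(2)]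
  have "{w \<in> plus_star n T. \<forall>i\<in>insert n X. w $ i = 0}
      = (\<lambda>v. append_bit v 0) ` {v \<in> T. \<forall>i\<in>X. v $ i = 0}" (is "?L = ?R")
  proof
    \<comment> \<open>With positions counted from 0, the appended bit sits at index
      \<open>n\<close>; vectors built from the complement of \<open>T\<close> carry a 1 there and
      drop out.\<close>
    show "?L \<subseteq> ?R"
      using assms(1) by (auto simp: plus_star_def old index_append_bit(2) subset_iff)
    show "?R \<subseteq> ?L"
      using assms(1) old by (auto simp: plus_star_def index_append_bit(2) subset_iff)
  qed
  moreover have "inj_on (\<lambda>v. append_bit v 0) {v \<in> T. \<forall>i\<in>X. v $ i = 0}"
    using assms(1) by (intro inj_onI) (blast intro: append_bit_eq_imp_eq)
  ultimately show ?thesis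
    by (simp add: card_image)
qed

theorem theorem6:
  fixes n :: nat and T :: "bit vec set"
  assumes "T \<subseteq> carrier_vec n"
  shows "powerful_set n T \<longleftrightarrow> powerful_set (n + 1) (plus_star n T)"
proof
  assume T: "powerful_set n T"
  have "plus_star n T \<subseteq> carrier_vec (n + 1)"
    using assms append_bit_carrier_vec unfolding plus_star_def by blast
  moreover have "\<exists>k. card {w \<in> plus_star n T. \<forall>i\<in>X. w $ i = 0} = 2 ^ k" if X: "X \<subseteq> {0..<n + 1}" for X
  proof (cases "n \<in> X")
    case True
    \<comment> \<open>Here \<open>X\<close> is \<open>insert n (X - {n})\<close>, so its count in
      \<open>plus_star n T\<close> is the count for \<open>X - {n}\<close> in
      \<open>T\<close>.\<close>
    have sub: "X - {n} \<subseteq> {0..<n}"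
      using X by (auto simp: subset_iff less_Suc_eq)
    then obtain k where "card {v \<in> T. \<forall>i\<in>X - {n}. v $ i = 0} = 2 ^ k"
      using T unfolding powerful_set_def by blast
    then show ?thesis
      using card_plus_star_zero_on_new[OF assms sub] True by (auto simp: insert_absorb)
  next
    case False
    then have "X \<subseteq> {0..<n}"
      using X by (fastforce simp: subset_iff less_Suc_eq)
    then show ?thesis
      using card_plus_star_zero_on_old[OF assms] by blast
  qed
  ultimately show "powerful_set (n + 1) (plus_star n T)"
    unfolding powerful_set_def by blast
next
  assume S: "powerful_set (n + 1) (plus_star n T)"
  have "\<exists>k. card {v \<in> T. \<forall>i\<in>X. v $ i = 0} = 2 ^ k" if X: "X \<subseteq> {0..<n}" for X
  proof -
    \<comment> \<open>Adding the new position to \<open>X\<close> isolates the copy of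
      \<open>T\<close> inside \<open>plus_star n T\<close>.\<close>
    have "insert n X \<subseteq> {0..<n + 1}"
      using X by auto
    then obtain k where "card {w \<in> plus_star n T. \<forall>i\<in>insert n X. w $ i = 0} = 2 ^ k"
      using S unfolding powerful_set_def by blast
    then show ?thesis
      unfolding card_plus_star_zero_on_new[OF assms X] by blast
  qed
  with assms show "powerful_set n T"
    unfolding powerful_set_def by blast
qed

end
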